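(* Let $n\ge1$ be an integer. The Radon transform is injective on the alternating group $A_n$ if and only if $n\geq4$.
   Context: For a finite group $G$ and $m\ge 2$ let $C_m$ be the cyclic group of order $m$, and let $\Gamma_m$ be the set of nontrivial homomorphisms $C_m\to G$. For $f:G\to\mathbb{C}$, $x\in G$ and $\gamma\in\Gamma_m$ put $R_mf(x,\gamma)=\sum_{t\in C_m}f(x\gamma(t))$. The Radon transform on $G$ is $Rf=(R_mf)_{m\ge2}$; it is injective on $G$ if the only $f:G\to\mathbb{C}$ with $R_mf=0$ for all $m\ge2$ is $f=0$. *)

theory Defs
  imports Complex_Main "HOL-Algebra.Elementary_Groups" "HOL-Algebra.Sym_Groups"
begin

(* The cyclic group of order m is rendered as Z/mZ, i.e. integer_mod_group m for m > 0.
   Elements of hom are constrained on the carrier only; the values of gamma outside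
   carrier (integer_mod_group m) are irrelevant for everything below. *)

definition nontrivial_homs :: "nat \<Rightarrow> ('g, 'b) monoid_scheme \<Rightarrow> (int \<Rightarrow> 'g) set" where
  "nontrivial_homs m G =
     {\<gamma> \<in> hom (integer_mod_group m) G. \<exists>t \<in> carrier (integer_mod_group m). \<gamma> t \<noteq> \<one>\<^bsub>G\<^esub>}"

definition radon :: "('g, 'b) monoid_scheme \<Rightarrow> nat \<Rightarrow> ('g \<Rightarrow> complex) \<Rightarrow> 'g \<Rightarrow> (int \<Rightarrow> 'g) \<Rightarrow> complex"
  where
  "radon G m f x \<gamma> = (\<Sum>t\<in>carrier (integer_mod_group m). f (x \<otimes>\<^bsub>G\<^esub> \<gamma> t))"

(* Meant for finite groups G.  A function on G is a function on the ambient type regarded on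
   carrier G, so "f = 0" and "R_m f = 0" are asserted on carrier G only. *)

definition radon_injective :: "('g, 'b) monoid_scheme \<Rightarrow> bool" where
  "radon_injective G \<longleftrightarrow>
     (\<forall>f :: 'g \<Rightarrow> complex.
        (\<forall>m\<ge>2. \<forall>x\<in>carrier G. \<forall>\<gamma>\<in>nontrivial_homs m G. radon G m f x \<gamma> = 0) \<longrightarrow>
        (\<forall>x\<in>carrier G. f x = 0))"

end

theory Submission
  imports Defs "HOL-Algebra.Multiplicative_Group" "HOL-Computational_Algebra.Primes"
begin

text \<open>
  The transform sums \<open>f\<close> over left cosets of nontrivial cyclic subgroups, up to a multiplicity,
  and two observations decide the matter.

  If a group contains a Klein four-group \<open>{1, a, b, ab}\<close>, then involutions alone suffice for
  injectivity (\<open>radon_injective_if_klein_four\<close>). A function in the kernel changes sign under right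
  translation by each of the three involutions; but \<open>ab\<close> is also a product of two of them, so
  translation by it preserves the sign as well, which forces \<open>f = -f\<close>. For \<open>n \<ge> 4\<close>, the double
  transpositions of four points together with the identity form such a subgroup of the
  alternating group.

  If a finite group is cyclic, then it has a faithful complex character
  (\<open>finite_cyclic_group_faithful_character\<close>). Composed with a nontrivial homomorphism from a cyclic
  group it is still nontrivial, so its sum vanishes by orthogonality: the character is a nonzero
  function in the kernel (\<open>not_radon_injective_if_faithful_character\<close>). For \<open>n \<le> 3\<close> the
  alternating group has order 1 or 3 and is therefore cyclic.
\<close>

section \<open>Groups containing a Klein four-group\<close>

text \<open>
  For \<open>m = 2\<close> an involution \<open>c\<close> is the image of the generator of the cyclic group of order 2,
  and the corresponding value of the transform is \<open>f x + f (x \<otimes> c)\<close>.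
\<close>

lemma (in group) radon_kernel_antisymmetric_under_involution:
  assumes ker: "\<forall>x\<in>carrier G. \<forall>\<gamma>\<in>nontrivial_homs 2 G. radon G 2 f x \<gamma> = 0"
    and c: "c \<in> carrier G" "c \<noteq> \<one>" "c \<otimes> c = \<one>"
    and x: "x \<in> carrier G"
  shows "f (x \<otimes> c) = - f x"
proof -
  define \<gamma> where "\<gamma> = (\<lambda>t::int. if t = 0 then \<one> else c)"
  have carr: "carrier (integer_mod_group 2) = {0, 1}"
    by (auto simp: carrier_integer_mod_group)
  have "\<gamma> \<in> hom (integer_mod_group 2) G"
    using c unfolding hom_def by (auto simp: carr \<gamma>_def)
  then have "\<gamma> \<in> nontrivial_homs 2 G"
    using c by (auto simp: nontrivial_homs_def carr \<gamma>_def)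
  then have "radon G 2 f x \<gamma> = 0"
    using ker x by blast
  then have "f x + f (x \<otimes> c) = 0"
    using x by (simp add: radon_def carr \<gamma>_def)
  then show ?thesis
    by (simp add: add_eq_0_iff)
qed

lemma (in group) radon_injective_if_klein_four:
  assumes a: "a \<in> carrier G" "a \<noteq> \<one>" "a \<otimes> a = \<one>"
    and b: "b \<in> carrier G" "b \<noteq> \<one>" "b \<otimes> b = \<one>"
    and comm: "a \<otimes> b = b \<otimes> a" and "a \<noteq> b"
  shows "radon_injective G"
  unfolding radon_injective_def
proof (intro allI impI ballI)
  fix f :: "'a \<Rightarrow> complex" and x
  assume "\<forall>m\<ge>2. \<forall>x\<in>carrier G. \<forall>\<gamma>\<in>nontrivial_homs m G. radon G m f x \<gamma> = 0"
    and x: "x \<in> carrier G"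
  then have ker: "\<forall>x\<in>carrier G. \<forall>\<gamma>\<in>nontrivial_homs 2 G. radon G 2 f x \<gamma> = 0"
    by simp
  note flip = radon_kernel_antisymmetric_under_involution[OF ker]
  have "a \<otimes> b \<noteq> \<one>"
    using a b \<open>a \<noteq> b\<close> by (metis right_cancel)
  moreover have "(a \<otimes> b) \<otimes> (a \<otimes> b) = \<one>"
  proof -
    have "(a \<otimes> b) \<otimes> (a \<otimes> b) = (a \<otimes> b) \<otimes> (b \<otimes> a)"
      by (simp only: comm)
    also have "\<dots> = a \<otimes> (b \<otimes> b) \<otimes> a"
      using a(1) b(1) by (simp add: m_assoc)
    finally show ?thesis
      using a b by simp
  qed
  ultimately have "f (x \<otimes> (a \<otimes> b)) = - f x"
    using flip a(1) b(1) x by simp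
  moreover have "f (x \<otimes> (a \<otimes> b)) = f x"
  proof -
    have "f (x \<otimes> (a \<otimes> b)) = f ((x \<otimes> a) \<otimes> b)"
      using x a b by (simp add: m_assoc)
    also have "\<dots> = - f (x \<otimes> a)"
      using flip[OF b] x a(1) by simp
    also have "\<dots> = f x"
      using flip[OF a x] by simp
    finally show ?thesis .
  qed
  ultimately have "f x = - f x"
    by simp
  then show "f x = 0"
    by simp
qed

lemma radon_injective_alt_group:
  assumes "n \<ge> 4"
  shows "radon_injective (alt_group n)"
proof -
  define a where "a = transpose 1 2 \<circ> transpose 3 (4::nat)"
  define b where "b = transpose 1 3 \<circ> transpose 2 (4::nat)"
  interpret group "alt_group n"
    by (rule alt_group_is_group)
  have double_transposition: "transpose i j \<circ> transpose k l \<in> carrier (alt_group n)"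
    if "i \<in> {1..n}" "j \<in> {1..n}" "k \<in> {1..n}" "l \<in> {1..n}" "i \<noteq> j" "k \<noteq> l" for i j k l
    using that unfolding alt_group_carrier
    by (simp add: permutes_compose permutes_swap_id evenperm_comp permutation_swap_id evenperm_swap)
  show ?thesis
  proof (rule radon_injective_if_klein_four)
    show "a \<in> carrier (alt_group n)" "b \<in> carrier (alt_group n)"
      using assms unfolding a_def b_def by (intro double_transposition; simp)+
    have "a 1 = 2" "b 1 = 3"
      by (simp_all add: a_def b_def transpose_def)
    then show "a \<noteq> \<one>\<^bsub>alt_group n\<^esub>" "b \<noteq> \<one>\<^bsub>alt_group n\<^esub>" "a \<noteq> b"
      by (auto simp: alt_group_one)
    show "a \<otimes>\<^bsub>alt_group n\<^esub> a = \<one>\<^bsub>alt_group n\<^esub>"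
         "b \<otimes>\<^bsub>alt_group n\<^esub> b = \<one>\<^bsub>alt_group n\<^esub>"
         "a \<otimes>\<^bsub>alt_group n\<^esub> b = b \<otimes>\<^bsub>alt_group n\<^esub> a"
      by (auto simp: alt_group_mult alt_group_one a_def b_def transpose_def fun_eq_iff)
  qed
qed

section \<open>Finite cyclic groups\<close>

text \<open>
  Orthogonality of characters: translating the summation variable by \<open>s\<close> multiplies the sum by
  \<open>\<psi> s \<noteq> 1\<close>, yet leaves it unchanged.
\<close>

lemma (in group) sum_nontrivial_character_eq_0:
  fixes \<psi> :: "'a \<Rightarrow> complex"
  assumes mult: "\<And>x y. x \<in> carrier G \<Longrightarrow> y \<in> carrier G \<Longrightarrow> \<psi> (x \<otimes> y) = \<psi> x * \<psi> y"
    and s: "s \<in> carrier G" "\<psi> s \<noteq> 1"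
  shows "(\<Sum>t\<in>carrier G. \<psi> t) = 0"
proof -
  have "bij_betw (\<lambda>t. s \<otimes> t) (carrier G) (carrier G)"
    using s by (simp add: bij_betw_def inj_on_cmult surj_const_mult)
  then have "(\<Sum>t\<in>carrier G. \<psi> t) = (\<Sum>t\<in>carrier G. \<psi> (s \<otimes> t))"
    by (rule sum.reindex_bij_betw[symmetric])
  also have "\<dots> = \<psi> s * (\<Sum>t\<in>carrier G. \<psi> t)"
    using s by (simp add: mult sum_distrib_left)
  finally show ?thesis
    using s by simp
qed

lemma (in group) not_radon_injective_if_faithful_character:
  fixes \<chi> :: "'a \<Rightarrow> complex"
  assumes mult: "\<And>x y. x \<in> carrier G \<Longrightarrow> y \<in> carrier G \<Longrightarrow> \<chi> (x \<otimes> y) = \<chi> x * \<chi> y"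
    and faithful: "\<And>x. x \<in> carrier G \<Longrightarrow> \<chi> x = 1 \<longleftrightarrow> x = \<one>"
  shows "\<not> radon_injective G"
proof
  assume inj: "radon_injective G"
  have "radon G m \<chi> x \<gamma> = 0" if x: "x \<in> carrier G" and \<gamma>: "\<gamma> \<in> nontrivial_homs m G" for m x \<gamma>
  proof -
    let ?C = "integer_mod_group m"
    interpret C: group ?C
      by simp
    have hom: "\<gamma> \<in> hom ?C G"
      using \<gamma> by (simp add: nontrivial_homs_def)
    obtain s where s: "s \<in> carrier ?C" "\<gamma> s \<noteq> \<one>"
      using \<gamma> by (auto simp: nontrivial_homs_def)
    have closed: "\<gamma> t \<in> carrier G" if "t \<in> carrier ?C" for t
      using hom that by (rule hom_in_carrier)
    have "(\<Sum>t\<in>carrier ?C. \<chi> (\<gamma> t)) = 0"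
    proof (rule C.sum_nontrivial_character_eq_0)
      show "\<chi> (\<gamma> (t \<otimes>\<^bsub>?C\<^esub> u)) = \<chi> (\<gamma> t) * \<chi> (\<gamma> u)"
        if "t \<in> carrier ?C" "u \<in> carrier ?C" for t u
        using hom_mult[OF hom that] mult closed that by metis
      show "\<chi> (\<gamma> s) \<noteq> 1"
        using faithful closed s by simp
    qed (fact s)
    then show ?thesis
      using x closed by (simp add: radon_def mult flip: sum_distrib_left)
  qed
  then have "\<chi> \<one> = 0"
    using inj unfolding radon_injective_def by blast
  then show False
    using faithful[of \<one>] by simp
qed

text \<open>
  A generator \<open>g\<close> of order \<open>N\<close> is sent to the primitive \<open>N\<close>-th root of unity with argument
  \<open>2\<pi> / N\<close>. An element determines its exponent as a power of \<open>g\<close> only modulo \<open>N\<close>, which is exactly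
  the ambiguity that this root of unity does not see; equality with 1 detects exponents divisible
  by \<open>N\<close>, hence faithfulness.
\<close>

lemma (in group) finite_cyclic_group_faithful_character:
  assumes cyclic: "cyclic_group G" and fin: "finite (carrier G)"
  obtains \<chi> :: "'a \<Rightarrow> complex"
    where "\<And>x y. x \<in> carrier G \<Longrightarrow> y \<in> carrier G \<Longrightarrow> \<chi> (x \<otimes> y) = \<chi> x * \<chi> y"
      and "\<And>x. x \<in> carrier G \<Longrightarrow> \<chi> x = 1 \<longleftrightarrow> x = \<one>"
proof -
  obtain g where g: "g \<in> carrier G" and gen: "carrier G = range (\<lambda>k::int. g [^] k)"
    using cyclic unfolding cyclic_group by blast
  define N where "N = ord g"
  have N: "N > 0"
    using ord_ge_1[OF fin g] by (simp add: N_def)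
  define e where "e = (\<lambda>k::int. cis (2 * pi * of_int k / of_nat N))"
  have e_add: "e (k + l) = e k * e l" for k l
    by (simp add: e_def cis_mult add_divide_distrib distrib_left)
  have e_eq_1: "e k = 1 \<longleftrightarrow> int N dvd k" for k
  proof
    assume "e k = 1"
    then have "cos (2 * pi * of_int k / of_nat N) = 1"
      by (simp add: e_def complex_eq_iff)
    then obtain j :: int where "2 * pi * of_int k / of_nat N = of_int j * 2 * pi"
      unfolding cos_one_2pi_int by blast
    then have "real_of_int k = of_int (int N * j)"
      using N by (simp add: field_simps)
    then show "int N dvd k"
      unfolding of_int_eq_iff by simp
  next
    assume "int N dvd k"
    then obtain j where "k = int N * j" ..
    then have "2 * pi * of_int k / of_nat N = 2 * pi * of_int j"
      using N by simp
    then have "e k = cis (2 * pi * of_int j)"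
      by (simp only: e_def)
    also have "\<dots> = 1"
      by (rule cis_multiple_2pi) simp
    finally show "e k = 1" .
  qed
  define \<chi> where "\<chi> = (\<lambda>x. e (SOME k. x = g [^] (k::int)))"
  have \<chi>_pow: "\<chi> (g [^] k) = e k" for k :: int
  proof -
    define l where "l = (SOME l. g [^] k = g [^] (l::int))"
    have "g [^] k = g [^] l"
      unfolding l_def by (rule someI) simp
    then have "e (l - k) = 1"
      using int_pow_eq[OF g] by (simp add: e_eq_1 N_def)
    then have "e l = e k"
      using e_add[of "l - k" k] by simp
    then show ?thesis
      by (simp add: \<chi>_def l_def)
  qed
  show thesis
  proof (rule that)
    show "\<chi> (x \<otimes> y) = \<chi> x * \<chi> y" if xy: "x \<in> carrier G" "y \<in> carrier G" for x y
    proof -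
      obtain k l :: int where "x = g [^] k" "y = g [^] l"
        using xy unfolding gen by blast
      then show ?thesis
        using g by (simp add: \<chi>_pow e_add flip: int_pow_mult)
    qed
    show "\<chi> x = 1 \<longleftrightarrow> x = \<one>" if x: "x \<in> carrier G" for x
    proof -
      obtain k :: int where "x = g [^] k"
        using x unfolding gen by blast
      then show ?thesis
        using int_pow_eq_id[OF g] by (simp add: \<chi>_pow e_eq_1 N_def)
    qed
  qed
qed

lemma (in group) prime_order_imp_cyclic_group:
  assumes "prime (order G)"
  shows "cyclic_group G"
proof -
  have fin: "finite (carrier G)"
    using prime_gt_0_nat[OF assms] order_gt_0_iff_finite by simp
  have "carrier G \<noteq> {\<one>}"
    using assms by (auto simp: order_def)
  then obtain g where g: "g \<in> carrier G" "g \<noteq> \<one>"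
    using one_closed by blast
  then have "ord g = order G"
    using assms ord_dvd_group_order[OF g(1)] ord_eq_1[OF g(1)] unfolding prime_nat_iff by blast
  then have "card (carrier (subgroup_generated G {g})) = card (carrier G)"
    using cyclic_order_is_ord[OF g(1)] by (simp add: order_def)
  then have "carrier (subgroup_generated G {g}) = carrier G"
    using fin by (intro card_subset_eq carrier_subgroup_generated_subset)
  then show ?thesis
    unfolding cyclic_group using g(1) carrier_subgroup_generated_by_singleton[OF g(1)] by metis
qed

lemma cyclic_alt_group:
  assumes "n \<le> 3"
  shows "cyclic_group (alt_group n)"
proof -
  interpret group "alt_group n"
    by (rule alt_group_is_group)
  consider "n \<le> 1" | "n = 2" | "n = 3"
    using assms by linarith
  then show ?thesis
  proof cases
    case 1
    then have "carrier (alt_group n) = {id}"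
      by (cases n) (auto simp: alt_group_carrier)
    then show ?thesis
      by (intro trivial_imp_cyclic_group) (simp add: trivial_group_def alt_group_one)
  next
    case 2
    then have "card (carrier (alt_group n)) = 1"
      using alt_group_card_carrier[of n] by simp
    then have "carrier (alt_group n) = {\<one>\<^bsub>alt_group n\<^esub>}"
      using one_closed by (metis card_1_singletonE singletonD)
    then show ?thesis
      by (intro trivial_imp_cyclic_group) (simp add: trivial_group_def)
  next
    case 3
    then have "order (alt_group n) = 3"
      using alt_group_card_carrier[of n] by (simp add: order_def fact_numeral)
    then show ?thesis
      by (intro prime_order_imp_cyclic_group) simp
  qed
qed

lemma not_radon_injective_alt_group:
  assumes "n \<le> 3"
  shows "\<not> radon_injective (alt_group n)"
proof -
  interpret group "alt_group n"
    by (rule alt_group_is_group)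
  have "finite (carrier (alt_group n))"
    by (rule finite_subset[OF _ finite_permutations[of "{1..n}"]]) (auto simp: alt_group_carrier)
  with cyclic_alt_group[OF assms] show ?thesis
    by (rule finite_cyclic_group_faithful_character) (rule not_radon_injective_if_faithful_character)
qed

section \<open>The alternating groups\<close>

theorem proposition5p3:
  fixes n :: nat
  assumes "n \<ge> 1"
  shows "radon_injective (alt_group n) \<longleftrightarrow> n \<ge> 4"
  using radon_injective_alt_group[of n] not_radon_injective_alt_group[of n] by linarith

end
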